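(* Let $\mathbb{k}$ be a field, $G$ a finite abelian group, and let $q: G\to\mathbb{k}^\times$ be a weak quadratic form that is symmetric with respect to $g_0\in G$, i.e. $q(g)=q(g^{-1}g_0)$ for all $g\in G$. Then for all $g\in G$ and $k\in\mathbb{N}$ $$q(g^k)=q(g)^{k^2-s(k)}\,q(gg_0)^{s(k)},\qquad q(g^{-k})=q(g)^{s(k)}\,q(gg_0)^{k^2-s(k)}.$$
   Context: A map $q: G\to\mathbb{k}^\times$ is a weak quadratic form if $\beta_q(g_1,g_2)=q(g_1g_2)q(g_1)^{-1}q(g_2)^{-1}$ is a bihomomorphism $G\times G\to\mathbb{k}^\times$. The function $s:\mathbb{N}\to\mathbb{N}$ (denoted $\mathrm{sum}_{<}$ in the paper) is defined recursively by $s(0)=0$ and $s(n)=s(n-1)+(n-1)$, so $s(n)=1+2+\dots+(n-1)$ is the sum of all natural numbers strictly smaller than $n$. *)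

theory Defs
  imports "HOL-Algebra.Ring"
begin

definition assoc_bichar ::
  "('a, 'm) monoid_scheme \<Rightarrow> ('k, 'n) ring_scheme \<Rightarrow> ('a \<Rightarrow> 'k) \<Rightarrow> 'a \<Rightarrow> 'a \<Rightarrow> 'k" where
  "assoc_bichar G K q g1 g2 =
     q (g1 \<otimes>\<^bsub>G\<^esub> g2) \<otimes>\<^bsub>K\<^esub> inv\<^bsub>K\<^esub> (q g1) \<otimes>\<^bsub>K\<^esub> inv\<^bsub>K\<^esub> (q g2)"

text \<open>The target is \<open>units_of K\<close>, the multiplicative group of the field \<open>K\<close>.\<close>

definition bihomomorphism ::
  "('a, 'm) monoid_scheme \<Rightarrow> ('k, 'n) ring_scheme \<Rightarrow> ('a \<Rightarrow> 'a \<Rightarrow> 'k) \<Rightarrow> bool" where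
  "bihomomorphism G K b \<longleftrightarrow>
     (\<forall>h \<in> carrier G. (\<lambda>g. b g h) \<in> hom G (units_of K)) \<and>
     (\<forall>g \<in> carrier G. (\<lambda>h. b g h) \<in> hom G (units_of K))"

definition weak_quadratic_form ::
  "('a, 'm) monoid_scheme \<Rightarrow> ('k, 'n) ring_scheme \<Rightarrow> ('a \<Rightarrow> 'k) \<Rightarrow> bool" where
  "weak_quadratic_form G K q \<longleftrightarrow>
     q \<in> carrier G \<rightarrow> Units K \<and> bihomomorphism G K (assoc_bichar G K q)"

definition symmetric_wrt ::
  "('a, 'm) monoid_scheme \<Rightarrow> ('a \<Rightarrow> 'k) \<Rightarrow> 'a \<Rightarrow> bool" where
  "symmetric_wrt G q g0 \<longleftrightarrow> (\<forall>g \<in> carrier G. q g = q (inv\<^bsub>G\<^esub> g \<otimes>\<^bsub>G\<^esub> g0))"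

primrec sum_lt :: "nat \<Rightarrow> nat" where
  "sum_lt 0 = 0"
| "sum_lt (Suc n) = sum_lt n + n"

text \<open>Hence the natural-number subtraction in \<open>k ^ 2 - sum_lt k\<close> never truncates.\<close>

lemma sum_lt_le_square: "sum_lt k \<le> k ^ 2"
  by (induction k) (auto simp: power2_eq_square)

end

theory Submission
  imports Defs
begin

text \<open>
  With \<open>b\<close> the bicharacter of \<open>q\<close>, induction gives \<open>q(g^k) = q(g)^k b(g,g)^s(k)\<close>, and
  \<open>b(g,g) b(g,g^-1) = 1\<close> gives \<open>b(g,g) = q(g) q(g^-1)\<close>. Symmetry with respect to \<open>g0\<close> says that
  \<open>q(g^-1) = q(g g0)\<close>, and \<open>k + s(k) = k^2 - s(k)\<close>. Passing from \<open>g\<close> to \<open>g^-1\<close> exchanges \<open>q(g)\<close>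
  and \<open>q(g g0)\<close>, so the second formula is the first one for \<open>g^-1\<close>.
\<close>

text \<open>Phrased additively so that the induction never meets truncated subtraction; this is
  where the exponent \<open>k ^ 2 - sum_lt k\<close> comes from.\<close>

lemma add_two_sum_lt: "k + 2 * sum_lt k = k ^ 2"
  by (induction k) (auto simp: power2_eq_square)

context
  fixes G :: "('a, 'm) monoid_scheme" and K :: "('k, 'n) ring_scheme" and q :: "'a \<Rightarrow> 'k"
  assumes K: "cring K" and G: "comm_group G" and wqf: "weak_quadratic_form G K q"
begin

interpretation K: cring K by (fact K)
interpretation G: comm_group G by (fact G)

private abbreviation "b \<equiv> assoc_bichar G K q"

lemma weak_quadratic_form_Units [simp]: "g \<in> carrier G \<Longrightarrow> q g \<in> Units K"
  using wqf by (auto simp: weak_quadratic_form_def)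

lemma weak_quadratic_form_closed [simp]: "g \<in> carrier G \<Longrightarrow> q g \<in> carrier K"
  by (simp add: K.Units_closed)

lemma assoc_bichar_Units [simp]:
  "g \<in> carrier G \<Longrightarrow> h \<in> carrier G \<Longrightarrow> b g h \<in> Units K"
  using wqf unfolding weak_quadratic_form_def bihomomorphism_def hom_def units_of_def
  by (auto simp: Pi_iff)

lemma assoc_bichar_closed [simp]:
  "g \<in> carrier G \<Longrightarrow> h \<in> carrier G \<Longrightarrow> b g h \<in> carrier K"
  by (simp add: K.Units_closed)

lemma assoc_bichar_mult_left:
  assumes "g \<in> carrier G" "g' \<in> carrier G" "h \<in> carrier G"
  shows "b (g \<otimes>\<^bsub>G\<^esub> g') h = b g h \<otimes>\<^bsub>K\<^esub> b g' h"
  using wqf assms unfolding weak_quadratic_form_def bihomomorphism_def hom_def units_of_def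
  by simp

lemma weak_quadratic_form_mult:
  assumes "g \<in> carrier G" "h \<in> carrier G"
  shows "q (g \<otimes>\<^bsub>G\<^esub> h) = b g h \<otimes>\<^bsub>K\<^esub> q g \<otimes>\<^bsub>K\<^esub> q h"
proof -
  \<comment> \<open>The right side groups each value with its inverse. The rewriting is pure
    rearrangement; cancelling is left to the last step, since it would apply only to the side that
    is already grouped.\<close>
  have "b g h \<otimes>\<^bsub>K\<^esub> q g \<otimes>\<^bsub>K\<^esub> q h =
    q (g \<otimes>\<^bsub>G\<^esub> h) \<otimes>\<^bsub>K\<^esub> (inv\<^bsub>K\<^esub> (q g) \<otimes>\<^bsub>K\<^esub> q g) \<otimes>\<^bsub>K\<^esub> (inv\<^bsub>K\<^esub> (q h) \<otimes>\<^bsub>K\<^esub> q h)"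
    using assms unfolding assoc_bichar_def
    by (simp only: K.m_ac K.m_closed K.Units_inv_closed G.m_closed
        weak_quadratic_form_Units weak_quadratic_form_closed)
  then show ?thesis using assms by simp
qed

text \<open>Multiplicativity at \<open>\<one> \<otimes> \<one>\<close> makes this value idempotent,
  and an idempotent unit is trivial.\<close>

lemma assoc_bichar_one_left:
  assumes "h \<in> carrier G"
  shows "b \<one>\<^bsub>G\<^esub> h = \<one>\<^bsub>K\<^esub>"
  using assoc_bichar_mult_left[of "\<one>\<^bsub>G\<^esub>" "\<one>\<^bsub>G\<^esub>" h] assms
    K.Units_l_cancel[of "b \<one>\<^bsub>G\<^esub> h" "b \<one>\<^bsub>G\<^esub> h" "\<one>\<^bsub>K\<^esub>"]
  by simp

text \<open>Again an idempotent unit: the factor \<open>b \<one> \<one>\<close> in the expansion of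
  \<open>q (\<one> \<otimes> \<one>)\<close> is trivial.\<close>

lemma weak_quadratic_form_one: "q \<one>\<^bsub>G\<^esub> = \<one>\<^bsub>K\<^esub>"
  using weak_quadratic_form_mult[of "\<one>\<^bsub>G\<^esub>" "\<one>\<^bsub>G\<^esub>"] assoc_bichar_one_left[of "\<one>\<^bsub>G\<^esub>"]
    K.Units_l_cancel[of "q \<one>\<^bsub>G\<^esub>" "q \<one>\<^bsub>G\<^esub>" "\<one>\<^bsub>K\<^esub>"]
  by simp

lemma assoc_bichar_pow_left:
  assumes "g \<in> carrier G" "h \<in> carrier G"
  shows "b (g [^]\<^bsub>G\<^esub> (k::nat)) h = b g h [^]\<^bsub>K\<^esub> k"
  using assms by (induction k) (simp_all add: assoc_bichar_one_left assoc_bichar_mult_left)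

lemma assoc_bichar_diagonal:
  assumes g: "g \<in> carrier G"
  shows "b g g = q g \<otimes>\<^bsub>K\<^esub> q (inv\<^bsub>G\<^esub> g)"
proof -
  \<comment> \<open>The inserted factor is \<open>q \<one>\<close>. Writing the inverse on the left
    puts it in the first argument of \<open>b\<close>, where multiplicativity was proved.\<close>
  have "b g g = b g g \<otimes>\<^bsub>K\<^esub> q (inv\<^bsub>G\<^esub> g \<otimes>\<^bsub>G\<^esub> g)"
    using g by (simp add: weak_quadratic_form_one)
  also have "\<dots> = (b g g \<otimes>\<^bsub>K\<^esub> b (inv\<^bsub>G\<^esub> g) g) \<otimes>\<^bsub>K\<^esub> (q g \<otimes>\<^bsub>K\<^esub> q (inv\<^bsub>G\<^esub> g))"
    unfolding weak_quadratic_form_mult[OF G.inv_closed[OF g] g] using g by (simp add: K.m_ac)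
  also have "b g g \<otimes>\<^bsub>K\<^esub> b (inv\<^bsub>G\<^esub> g) g = \<one>\<^bsub>K\<^esub>"
    using g by (simp add: assoc_bichar_mult_left[symmetric] assoc_bichar_one_left)
  finally show ?thesis using g by simp
qed

lemma weak_quadratic_form_pow:
  assumes g: "g \<in> carrier G"
  shows "q (g [^]\<^bsub>G\<^esub> k) = q g [^]\<^bsub>K\<^esub> k \<otimes>\<^bsub>K\<^esub> b g g [^]\<^bsub>K\<^esub> sum_lt k"
proof (induction k)
  case 0
  then show ?case by (simp add: weak_quadratic_form_one)
next
  case (Suc k)
  \<comment> \<open>Appending one \<open>g\<close> costs \<open>b (g^k) g\<close>, which is the
    \<open>k\<close>-th power of \<open>b g g\<close>; this matches the increment \<open>k\<close>
    in the recursion of \<open>sum_lt\<close>.\<close>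
  have "q (g [^]\<^bsub>G\<^esub> Suc k) = b g g [^]\<^bsub>K\<^esub> k \<otimes>\<^bsub>K\<^esub> q (g [^]\<^bsub>G\<^esub> k) \<otimes>\<^bsub>K\<^esub> q g"
    using g by (simp add: weak_quadratic_form_mult assoc_bichar_pow_left)
  then show ?case
    using g by (simp add: Suc K.nat_pow_mult[symmetric] K.m_ac)
qed

text \<open>This is the symmetry condition taken at the inverse of \<open>g\<close>, whose own
  inverse is \<open>g\<close>.\<close>

lemma symmetric_weak_quadratic_form_inv:
  assumes "symmetric_wrt G q g0" "g \<in> carrier G"
  shows "q (inv\<^bsub>G\<^esub> g) = q (g \<otimes>\<^bsub>G\<^esub> g0)"
  using assms G.inv_closed[OF assms(2)] G.inv_inv[OF assms(2)]
  unfolding symmetric_wrt_def by metis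

lemma symmetric_weak_quadratic_form_pow:
  assumes sym: "symmetric_wrt G q g0" and g: "g \<in> carrier G" and g0: "g0 \<in> carrier G"
  shows "q (g [^]\<^bsub>G\<^esub> k) =
    q g [^]\<^bsub>K\<^esub> (k ^ 2 - sum_lt k) \<otimes>\<^bsub>K\<^esub> q (g \<otimes>\<^bsub>G\<^esub> g0) [^]\<^bsub>K\<^esub> sum_lt k"
proof -
  \<comment> \<open>Each of the \<open>sum_lt k\<close> factors \<open>b g g\<close> contributes one
    more \<open>q g\<close> to the \<open>k\<close> already present.\<close>
  have exponent: "k ^ 2 - sum_lt k = k + sum_lt k"
    using add_two_sum_lt[of k] by simp
  show ?thesis
    using g g0 unfolding exponent weak_quadratic_form_pow[OF g] assoc_bichar_diagonal[OF g]
      symmetric_weak_quadratic_form_inv[OF sym g]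
    by (simp add: K.nat_pow_distrib K.nat_pow_mult[symmetric] K.m_assoc)
qed

lemma symmetric_weak_quadratic_form_pow_neg:
  assumes sym: "symmetric_wrt G q g0" and g: "g \<in> carrier G" and g0: "g0 \<in> carrier G"
  shows "q (g [^]\<^bsub>G\<^esub> (- int k)) =
    q g [^]\<^bsub>K\<^esub> sum_lt k \<otimes>\<^bsub>K\<^esub> q (g \<otimes>\<^bsub>G\<^esub> g0) [^]\<^bsub>K\<^esub> (k ^ 2 - sum_lt k)"
proof -
  have "g [^]\<^bsub>G\<^esub> (- int k) = inv\<^bsub>G\<^esub> g [^]\<^bsub>G\<^esub> k"
    using g by (simp add: G.int_pow_neg int_pow_int G.nat_pow_inv)
  \<comment> \<open>Symmetry at \<open>g\<close> itself: the second base of the formula for the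
    inverse is again \<open>q g\<close>, while the first becomes
    \<open>q (g \<otimes> g0)\<close>.\<close>
  moreover have "q (inv\<^bsub>G\<^esub> g \<otimes>\<^bsub>G\<^esub> g0) = q g"
    using sym g by (simp add: symmetric_wrt_def)
  ultimately show ?thesis
    using symmetric_weak_quadratic_form_pow[OF sym G.inv_closed[OF g] g0, of k] g g0
    by (simp add: symmetric_weak_quadratic_form_inv[OF sym g] K.m_comm)
qed

end

theorem lemma4p2p10:
  fixes G :: "('a, 'm) monoid_scheme" and K :: "('k, 'n) ring_scheme"
    and q :: "'a \<Rightarrow> 'k" and g0 g :: 'a and k :: nat
  assumes "field K"
    and "comm_group G" and "finite (carrier G)"
    and "weak_quadratic_form G K q"
    and "g0 \<in> carrier G" and "symmetric_wrt G q g0"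
    and "g \<in> carrier G"
  shows "q (g [^]\<^bsub>G\<^esub> k) =
           q g [^]\<^bsub>K\<^esub> (k ^ 2 - sum_lt k) \<otimes>\<^bsub>K\<^esub> q (g \<otimes>\<^bsub>G\<^esub> g0) [^]\<^bsub>K\<^esub> sum_lt k
       \<and> q (g [^]\<^bsub>G\<^esub> (- int k)) =
           q g [^]\<^bsub>K\<^esub> sum_lt k \<otimes>\<^bsub>K\<^esub> q (g \<otimes>\<^bsub>G\<^esub> g0) [^]\<^bsub>K\<^esub> (k ^ 2 - sum_lt k)"
proof -
  have "cring K"
    using assms(1) by (simp add: field_def domain_def)
  with assms show ?thesis
    by (simp add: symmetric_weak_quadratic_form_pow symmetric_weak_quadratic_form_pow_neg)
qed

end
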